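(* Let $I=[0,1]$ and let $\phi:I\to\mathbb{R}$ satisfy $\phi(0)=\phi(1)=0$ and $|\phi(x)-\phi(y)|\le|x-y|$ for all $x,y\in I$. Let $\theta\in[-1,1]$, let $C_\theta(u,v)=uv+\theta\,\phi(u)\phi(v)$ for $(u,v)\in I^2$, and let $(X,Y)$ be a pair of real random variables with associated copula $C_\theta$. (i) If $X$ and $Y$ are identically distributed, then $X$ and $Y$ are exchangeable. Moreover, let $(a,b)\in\mathbb{R}^2$ and suppose that $(X,Y)$ is marginally symmetric about $(a,b)$. Then: (ii) $(X,Y)$ is radially symmetric about $(a,b)$ if and only if either $\phi(u)=\phi(1-u)$ for all $u\in I$, or $\phi(u)=-\phi(1-u)$ for all $u\in I$. (iii) $(X,Y)$ is jointly symmetric about $(a,b)$ if and only if $\phi(u)=-\phi(1-u)$ for all $u\in I$.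
   Context: Under the stated conditions on $\phi$, $C_\theta$ is a bivariate copula (a bivariate distribution function on $I^2$ with uniform margins) for every $\theta\in[-1,1]$. The pair $(X,Y)$ with marginal distribution functions $F,G$ has associated copula $C$ if $P(X\le x,Y\le y)=C(F(x),G(y))$ for all $(x,y)\in\mathbb{R}^2$. A random variable $X$ is symmetric about $a$ if $X-a$ and $a-X$ have the same cumulative distribution function. $X$ and $Y$ are exchangeable if $(X,Y)$ and $(Y,X)$ are identically distributed. $(X,Y)$ is marginally symmetric about $(a,b)$ if $X$ is symmetric about $a$ and $Y$ is symmetric about $b$. $(X,Y)$ is radially symmetric about $(a,b)$ if $(X-a,Y-b)$ and $(a-X,b-Y)$ have the same joint cumulative distribution function. $(X,Y)$ is jointly symmetric about $(a,b)$ if the four pairs $(X-a,Y-b)$, $(a-X,b-Y)$, $(X-a,b-Y)$, $(a-X,Y-b)$ have a common joint cumulative distribution function.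
   Formalization: The "only if" parts of (ii) and (iii) are stated only for θ ≠ 0 and continuous marginal distribution functions F, G; without this they fail (e.g. θ = 0, or X = Y = 0 almost surely, with φ(u) = min(u,(1−u)/3)). Part (i) and the "if" parts are unrestricted. *)

theory Defs
  imports "HOL-Probability.Probability"
begin

definition joint_cdf ::
  "'w measure \<Rightarrow> ('w \<Rightarrow> real) \<Rightarrow> ('w \<Rightarrow> real) \<Rightarrow> real \<Rightarrow> real \<Rightarrow> real"
where
  "joint_cdf M X Y x y = measure M {w \<in> space M. X w \<le> x \<and> Y w \<le> y}"

(* The values of a distribution function lie in [0,1], so only the restriction of C to
   the unit square matters. That C is a copula is not part of the definition. *)
definition has_associated_copula ::
  "'w measure \<Rightarrow> ('w \<Rightarrow> real) \<Rightarrow> ('w \<Rightarrow> real) \<Rightarrow> (real \<Rightarrow> real \<Rightarrow> real) \<Rightarrow> bool"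
where
  "has_associated_copula M X Y C \<longleftrightarrow>
     (\<forall>x y. joint_cdf M X Y x y = C (cdf (distr M borel X) x) (cdf (distr M borel Y) y))"

definition C_theta :: "(real \<Rightarrow> real) \<Rightarrow> real \<Rightarrow> real \<Rightarrow> real \<Rightarrow> real" where
  "C_theta \<phi> \<theta> u v = u * v + \<theta> * \<phi> u * \<phi> v"

definition identically_distributed ::
  "'w measure \<Rightarrow> ('w \<Rightarrow> real) \<Rightarrow> ('w \<Rightarrow> real) \<Rightarrow> bool"
where
  "identically_distributed M X Y \<longleftrightarrow> distr M borel X = distr M borel Y"

definition exchangeable :: "'w measure \<Rightarrow> ('w \<Rightarrow> real) \<Rightarrow> ('w \<Rightarrow> real) \<Rightarrow> bool" where
  "exchangeable M X Y \<longleftrightarrow>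
     distr M (borel \<Otimes>\<^sub>M borel) (\<lambda>w. (X w, Y w)) =
     distr M (borel \<Otimes>\<^sub>M borel) (\<lambda>w. (Y w, X w))"

definition symmetric_about :: "'w measure \<Rightarrow> ('w \<Rightarrow> real) \<Rightarrow> real \<Rightarrow> bool" where
  "symmetric_about M X a \<longleftrightarrow>
     cdf (distr M borel (\<lambda>w. X w - a)) = cdf (distr M borel (\<lambda>w. a - X w))"

definition marginally_symmetric ::
  "'w measure \<Rightarrow> ('w \<Rightarrow> real) \<Rightarrow> ('w \<Rightarrow> real) \<Rightarrow> real \<Rightarrow> real \<Rightarrow> bool"
where
  "marginally_symmetric M X Y a b \<longleftrightarrow> symmetric_about M X a \<and> symmetric_about M Y b"

definition radially_symmetric ::
  "'w measure \<Rightarrow> ('w \<Rightarrow> real) \<Rightarrow> ('w \<Rightarrow> real) \<Rightarrow> real \<Rightarrow> real \<Rightarrow> bool"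
where
  "radially_symmetric M X Y a b \<longleftrightarrow>
     joint_cdf M (\<lambda>w. X w - a) (\<lambda>w. Y w - b) = joint_cdf M (\<lambda>w. a - X w) (\<lambda>w. b - Y w)"

definition jointly_symmetric ::
  "'w measure \<Rightarrow> ('w \<Rightarrow> real) \<Rightarrow> ('w \<Rightarrow> real) \<Rightarrow> real \<Rightarrow> real \<Rightarrow> bool"
where
  "jointly_symmetric M X Y a b \<longleftrightarrow>
     joint_cdf M (\<lambda>w. X w - a) (\<lambda>w. Y w - b) = joint_cdf M (\<lambda>w. a - X w) (\<lambda>w. b - Y w) \<and>
     joint_cdf M (\<lambda>w. X w - a) (\<lambda>w. Y w - b) = joint_cdf M (\<lambda>w. X w - a) (\<lambda>w. b - Y w) \<and>
     joint_cdf M (\<lambda>w. X w - a) (\<lambda>w. Y w - b) = joint_cdf M (\<lambda>w. a - X w) (\<lambda>w. Y w - b)"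

end

theory Submission imports Defs
begin

text \<open>
  Put \<open>u = F (a + x)\<close> and \<open>v = G (b + y)\<close>. Marginal symmetry says that \<open>1 - u\<close> is the left limit of
  \<open>F\<close> at \<open>a - x\<close>, and likewise for \<open>v\<close>. As \<open>C\<^sub>\<theta>\<close> is continuous on the unit square, it also
  links the left limits, so that inclusion-exclusion computes the distribution functions of the
  reflected pairs at \<open>(x, y)\<close> as \<open>u v\<close> plus \<open>\<theta> \<phi>(1-u) \<phi>(1-v)\<close>, \<open>-\<theta> \<phi>(u) \<phi>(1-v)\<close> and
  \<open>-\<theta> \<phi>(1-u) \<phi>(v)\<close>, respectively. The symmetries thus become functional equations for \<open>\<phi>\<close>
  on the ranges of \<open>F\<close> and \<open>G\<close>; these ranges contain \<open>(0,1)\<close> if \<open>F\<close> and \<open>G\<close> are continuous.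
\<close>

section \<open>The joint distribution function determines the law of a pair\<close>

lemma distr_pair_eqI:
  assumes "prob_space M"
    and [measurable]: "X \<in> borel_measurable M" "Y \<in> borel_measurable M"
      "X' \<in> borel_measurable M" "Y' \<in> borel_measurable M"
    and eq: "joint_cdf M X Y = joint_cdf M X' Y'"
  shows "distr M (borel \<Otimes>\<^sub>M borel) (\<lambda>w. (X w, Y w)) = distr M (borel \<Otimes>\<^sub>M borel) (\<lambda>w. (X' w, Y' w))"
    (is "?P = ?Q")
proof -
  interpret prob_space M by fact
  have emeasure_distr_atMost: "emeasure (distr M (borel \<Otimes>\<^sub>M borel) (\<lambda>w. (U w, V w))) {..p}
      = ennreal (joint_cdf M U V (fst p) (snd p))"
    if [measurable]: "U \<in> borel_measurable M" "V \<in> borel_measurable M"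
    for U V :: "'a \<Rightarrow> real" and p
  proof -
    have "{..p} \<in> sets (borel \<Otimes>\<^sub>M borel)"
      unfolding borel_prod by (rule borel_closed) (rule closed_eucl_atMost)
    moreover have "(\<lambda>w. (U w, V w)) -` {..p} \<inter> space M
        = {w \<in> space M. U w \<le> fst p \<and> V w \<le> snd p}"
      by (auto simp: less_eq_prod_def)
    ultimately show ?thesis
      by (simp add: emeasure_distr joint_cdf_def emeasure_eq_measure)
  qed
  have sets_eq: "sets (borel \<Otimes>\<^sub>M borel) = sigma_sets UNIV (range (\<lambda>p::real \<times> real. {..p}))"
    unfolding borel_prod by (subst borel_eq_atMost) simp
  show ?thesis
  \<comment> \<open>The order on pairs is componentwise, so \<open>{..p}\<close> is a lower left
    quadrant. The quadrants are closed under intersection and generate the Borel sets, and those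
    with corners on the diagonal exhaust the plane.\<close>
  proof (rule measure_eqI_generator_eq[where \<Omega> = UNIV and E = "range (\<lambda>p::real \<times> real. {..p})"
        and A = "\<lambda>n. {..(real n, real n)}"])
    show "Int_stable (range (\<lambda>p::real \<times> real. {..p}))"
    proof (rule Int_stableI)
      fix a b assume "a \<in> range (\<lambda>p::real \<times> real. {..p})" "b \<in> range (\<lambda>p::real \<times> real. {..p})"
      then obtain p q where "a = {..p}" "b = {..q}" by auto
      then have "a \<inter> b = {..inf p q}" by auto
      then show "a \<inter> b \<in> range (\<lambda>p::real \<times> real. {..p})" by blast
    qed
    show "(\<Union>n. {..(real n, real n)}) = UNIV"
    proof (intro equalityI subsetI UNIV_I UN_I)
      fix p :: "real \<times> real"
      have "fst p \<le> real (nat \<lceil>max (fst p) (snd p)\<rceil>)" "snd p \<le> real (nat \<lceil>max (fst p) (snd p)\<rceil>)"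
        by linarith+
      then show "p \<in> {..(real (nat \<lceil>max (fst p) (snd p)\<rceil>), real (nat \<lceil>max (fst p) (snd p)\<rceil>))}"
        by (simp add: less_eq_prod_def)
    qed
    show "sets ?P = sigma_sets UNIV (range (\<lambda>p. {..p}))"
      "sets ?Q = sigma_sets UNIV (range (\<lambda>p. {..p}))"
      using sets_eq by simp_all
    show "emeasure ?P S = emeasure ?Q S" if "S \<in> range (\<lambda>p. {..p})" for S
      using that by (auto simp: emeasure_distr_atMost eq)
    show "emeasure ?P {..(real i, real i)} \<noteq> \<infinity>" for i
      by (simp add: emeasure_distr_atMost)
  qed auto
qed

section \<open>Marginal distribution functions, symmetry of \<open>C_theta\<close> and left
  limits\<close>

lemma cdf_distr_eq:
  assumes [measurable]: "X \<in> borel_measurable M"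
  shows "cdf (distr M borel X) x = measure M {w \<in> space M. X w \<le> x}"
proof -
  have "X -` {..x} \<inter> space M = {w \<in> space M. X w \<le> x}" by auto
  then show ?thesis by (simp add: cdf_def measure_distr)
qed

lemma cdf_distr_in_unit:
  assumes "prob_space M" "X \<in> borel_measurable M"
  shows "cdf (distr M borel X) x \<in> {0..1}"
  using assms by (simp add: cdf_distr_eq prob_space.prob_le_1)

lemma joint_cdf_commute: "joint_cdf M Y X y x = joint_cdf M X Y x y"
  by (simp add: joint_cdf_def conj_commute)

lemma C_theta_commute: "C_theta \<phi> \<theta> v u = C_theta \<phi> \<theta> u v"
  by (simp add: C_theta_def)

lemma has_associated_copula_swap:
  assumes "has_associated_copula M X Y (C_theta \<phi> \<theta>)"
  shows "has_associated_copula M Y X (C_theta \<phi> \<theta>)"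
  using assms unfolding has_associated_copula_def
  by (metis C_theta_commute joint_cdf_commute)

text \<open>Probability is continuous from below and \<open>C_theta\<close> is continuous because
  \<phi> is, so both sides of the hypothesis converge. Applied to events
  \<open>X \<le> x - 1/(n+1)\<close>, this carries the copula relation from weak to strict
  inequalities.\<close>

lemma (in prob_space) C_theta_incseq_limit:
  assumes cont: "continuous_on {0..1} \<phi>"
    and A: "range A \<subseteq> events" "incseq A" and B: "range B \<subseteq> events" "incseq B"
    and C: "\<And>n::nat. prob (A n \<inter> B n) = C_theta \<phi> \<theta> (prob (A n)) (prob (B n))"
  shows "prob ((\<Union>n. A n) \<inter> (\<Union>n. B n)) = C_theta \<phi> \<theta> (prob (\<Union>n. A n)) (prob (\<Union>n. B n))"
proof -
  have limA: "(\<lambda>n. prob (A n)) \<longlonglongrightarrow> prob (\<Union>n. A n)"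
    and limB: "(\<lambda>n. prob (B n)) \<longlonglongrightarrow> prob (\<Union>n. B n)"
    using A B by (auto intro: finite_Lim_measure_incseq)
  have "(\<lambda>n. prob (A n \<inter> B n)) \<longlonglongrightarrow> prob (\<Union>n. A n \<inter> B n)"
    using A B by (intro finite_Lim_measure_incseq) (auto simp: incseq_def subset_iff)
  \<comment> \<open>A point may enter the two sequences at different indices; by monotonicity it
    lies in both sets at the larger one.\<close>
  moreover have "(\<Union>n. A n \<inter> B n) = (\<Union>n. A n) \<inter> (\<Union>n. B n)"
  proof (intro equalityI subsetI)
    fix w assume "w \<in> (\<Union>n. A n) \<inter> (\<Union>n. B n)"
    then obtain m n where "w \<in> A m" "w \<in> B n" by auto
    then have "w \<in> A (max m n) \<inter> B (max m n)"
      using monoD[OF A(2), of m "max m n"] monoD[OF B(2), of n "max m n"] by auto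
    then show "w \<in> (\<Union>n. A n \<inter> B n)" by blast
  qed auto
  ultimately have "(\<lambda>n. C_theta \<phi> \<theta> (prob (A n)) (prob (B n))) \<longlonglongrightarrow> prob ((\<Union>n. A n) \<inter> (\<Union>n. B n))"
    using C by simp
  moreover have "(\<lambda>n. C_theta \<phi> \<theta> (prob (A n)) (prob (B n)))
      \<longlonglongrightarrow> C_theta \<phi> \<theta> (prob (\<Union>n. A n)) (prob (\<Union>n. B n))"
    unfolding C_theta_def
    by (intro tendsto_intros limA limB continuous_on_tendsto_compose[OF cont limA]
        continuous_on_tendsto_compose[OF cont limB]) auto
  ultimately show ?thesis by (rule LIMSEQ_unique)
qed

lemma less_Collect_eq_UN:
  fixes X :: "'w \<Rightarrow> real"
  shows "{w \<in> space M. X w < x} = (\<Union>n. {w \<in> space M. X w \<le> x - inverse (real (Suc n))})"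
proof (intro equalityI subsetI)
  fix w assume "w \<in> {w \<in> space M. X w < x}"
  moreover then obtain n where "inverse (real (Suc n)) < x - X w"
    using reals_Archimedean[of "x - X w"] by auto
  ultimately show "w \<in> (\<Union>n. {w \<in> space M. X w \<le> x - inverse (real (Suc n))})"
    by (auto intro!: exI[of _ n])
next
  fix w assume "w \<in> (\<Union>n. {w \<in> space M. X w \<le> x - inverse (real (Suc n))})"
  then obtain n where "w \<in> space M" "X w \<le> x - inverse (real (Suc n))" by blast
  moreover have "inverse (real (Suc n)) > 0" by simp
  ultimately show "w \<in> {w \<in> space M. X w < x}"
    by (smt (verit) mem_Collect_eq)
qed

lemma incseq_atMost_minus_inverse:
  fixes X :: "'w \<Rightarrow> real"
  shows "incseq (\<lambda>n. {w \<in> space M. X w \<le> x - inverse (real (Suc n))})"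
proof (rule incseq_SucI, clarify)
  fix n w assume "X w \<le> x - inverse (real (Suc n))"
  moreover have "inverse (real (Suc (Suc n))) \<le> inverse (real (Suc n))"
    by (rule le_imp_inverse_le) auto
  ultimately show "X w \<le> x - inverse (real (Suc (Suc n)))" by linarith
qed

text \<open>Reflection turns a weak inequality into the complement of a strict one. The strict event
  keeps the formula exact when \<open>Z\<close> has an atom at \<open>c - z\<close>.\<close>

lemma (in prob_space) symmetric_about_left_limit:
  assumes [measurable]: "Z \<in> borel_measurable M" and "symmetric_about M Z c"
  shows "prob {w \<in> space M. Z w < c - z} = 1 - cdf (distr M borel Z) (c + z)"
proof -
  have "cdf (distr M borel Z) (c + z) = prob {w \<in> space M. Z w - c \<le> z}"
    by (simp add: cdf_distr_eq algebra_simps)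
  also have "\<dots> = prob {w \<in> space M. c - Z w \<le> z}"
    using fun_cong[OF assms(2)[unfolded symmetric_about_def], of z] by (simp add: cdf_distr_eq)
  also have "{w \<in> space M. c - Z w \<le> z} = space M - {w \<in> space M. Z w < c - z}"
    by auto
  finally show ?thesis by (simp add: prob_compl)
qed

section \<open>Joint distribution functions of the reflected pairs\<close>

context
  fixes \<phi> :: "real \<Rightarrow> real" and \<theta> :: real
    and M :: "'w measure" and X Y :: "'w \<Rightarrow> real"
  assumes prob: "prob_space M"
    and [measurable]: "X \<in> borel_measurable M" "Y \<in> borel_measurable M"
    and cont: "continuous_on {0..1} \<phi>"
    and cop: "has_associated_copula M X Y (C_theta \<phi> \<theta>)"
begin

interpretation prob_space M by (fact prob)

lemma copula_le_le:
  "prob ({w \<in> space M. X w \<le> x} \<inter> {w \<in> space M. Y w \<le> y})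
    = C_theta \<phi> \<theta> (prob {w \<in> space M. X w \<le> x}) (prob {w \<in> space M. Y w \<le> y})"
proof -
  have "{w \<in> space M. X w \<le> x} \<inter> {w \<in> space M. Y w \<le> y} = {w \<in> space M. X w \<le> x \<and> Y w \<le> y}"
    by auto
  then show ?thesis
    using cop by (simp add: has_associated_copula_def cdf_distr_eq joint_cdf_def)
qed

lemma copula_le_less:
  "prob ({w \<in> space M. X w \<le> x} \<inter> {w \<in> space M. Y w < y})
    = C_theta \<phi> \<theta> (prob {w \<in> space M. X w \<le> x}) (prob {w \<in> space M. Y w < y})"
  \<comment> \<open>The constant sequence keeps the event for \<open>X\<close> fixed, so only
    \<open>Y\<close> passes to the left limit.\<close>
  using C_theta_incseq_limit[OF cont,
      of "\<lambda>_. {w \<in> space M. X w \<le> x}" "\<lambda>n. {w \<in> space M. Y w \<le> y - inverse (real (Suc n))}"]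
    copula_le_le incseq_atMost_minus_inverse[of M Y y]
  by (simp add: less_Collect_eq_UN[of M Y y] image_subset_iff del: of_nat_Suc)

lemma copula_less_less:
  "prob ({w \<in> space M. X w < x} \<inter> {w \<in> space M. Y w < y})
    = C_theta \<phi> \<theta> (prob {w \<in> space M. X w < x}) (prob {w \<in> space M. Y w < y})"
  using C_theta_incseq_limit[OF cont, of "\<lambda>n. {w \<in> space M. X w \<le> x - inverse (real (Suc n))}"
      "\<lambda>n. {w \<in> space M. Y w \<le> y - inverse (real (Suc n))}"]
    copula_le_le incseq_atMost_minus_inverse[of M X x] incseq_atMost_minus_inverse[of M Y y]
  by (simp add: less_Collect_eq_UN[of M Y y] less_Collect_eq_UN[of M X x] image_subset_iff
      del: of_nat_Suc)

lemma joint_cdf_shift: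
  "joint_cdf M (\<lambda>w. X w - a) (\<lambda>w. Y w - b) x y
    = C_theta \<phi> \<theta> (cdf (distr M borel X) (a + x)) (cdf (distr M borel Y) (b + y))"
proof -
  have "joint_cdf M (\<lambda>w. X w - a) (\<lambda>w. Y w - b) x y = joint_cdf M X Y (a + x) (b + y)"
    by (simp add: joint_cdf_def algebra_simps)
  then show ?thesis using cop by (simp add: has_associated_copula_def)
qed

text \<open>With \<open>A\<close> and \<open>B\<close> as in the proof, the probability is
  \<open>prob A - prob (A \<inter> B)\<close>, that is,
  \<open>u - C_theta \<phi> \<theta> u (1 - v)\<close>. The product part of the copula leaves
  \<open>u * v\<close>, and the subtraction produces the minus sign at \<theta>.\<close>

lemma joint_cdf_reflect_snd:
  assumes "symmetric_about M Y b"
  defines "u \<equiv> \<lambda>x. cdf (distr M borel X) x" and "v \<equiv> \<lambda>y. cdf (distr M borel Y) y"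
  shows "joint_cdf M (\<lambda>w. X w - a) (\<lambda>w. b - Y w) x y
    = u (a + x) * v (b + y) - \<theta> * \<phi> (u (a + x)) * \<phi> (1 - v (b + y))"
proof -
  let ?A = "{w \<in> space M. X w \<le> a + x}" and ?B = "{w \<in> space M. Y w < b - y}"
  have "{w \<in> space M. X w - a \<le> x \<and> b - Y w \<le> y} = ?A - ?A \<inter> ?B" by auto
  then have "joint_cdf M (\<lambda>w. X w - a) (\<lambda>w. b - Y w) x y = prob ?A - prob (?A \<inter> ?B)"
    by (simp add: joint_cdf_def finite_measure_Diff)
  also have "\<dots> = u (a + x) - C_theta \<phi> \<theta> (u (a + x)) (1 - v (b + y))"
    unfolding u_def v_def copula_le_less
    by (simp add: symmetric_about_left_limit[OF _ assms(1)] cdf_distr_eq)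
  finally show ?thesis by (simp add: C_theta_def algebra_simps)
qed

text \<open>The right-hand side is the survival copula of \<open>C_theta \<phi> \<theta>\<close>,
  which belongs to the same family with \<phi> reflected, since
  \<open>u + v - 1 + (1 - u) * (1 - v) = u * v\<close>.\<close>

lemma joint_cdf_reflect_both:
  assumes "symmetric_about M X a" "symmetric_about M Y b"
  shows "joint_cdf M (\<lambda>w. a - X w) (\<lambda>w. b - Y w) x y
    = C_theta (\<lambda>t. \<phi> (1 - t)) \<theta> (cdf (distr M borel X) (a + x)) (cdf (distr M borel Y) (b + y))"
    (is "_ = C_theta _ _ ?u ?v")
proof -
  let ?A = "{w \<in> space M. X w < a - x}" and ?B = "{w \<in> space M. Y w < b - y}"
  have "{w \<in> space M. a - X w \<le> x \<and> b - Y w \<le> y} = space M - (?A \<union> ?B)" by auto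
  then have "joint_cdf M (\<lambda>w. a - X w) (\<lambda>w. b - Y w) x y = 1 - prob (?A \<union> ?B)"
    by (simp add: joint_cdf_def prob_compl)
  also have "\<dots> = 1 - (prob ?A + prob ?B - prob (?A \<inter> ?B))"
    using measure_Un3[of ?A M ?B] by (simp add: fmeasurable_eq_sets)
  also have "\<dots> = 1 - ((1 - ?u) + (1 - ?v) - C_theta \<phi> \<theta> (1 - ?u) (1 - ?v))"
    unfolding copula_less_less by (simp add: symmetric_about_left_limit assms)
  finally show ?thesis by (simp add: C_theta_def algebra_simps)
qed

end

text \<open>This is the reflection of the second coordinate with \<open>X\<close> and
  \<open>Y\<close> interchanged, which the symmetry of \<open>C_theta\<close> permits. It stands
  outside the context because there the roles of \<open>X\<close> and \<open>Y\<close> are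
  fixed.\<close>

lemma joint_cdf_reflect_fst:
  assumes "prob_space M" "X \<in> borel_measurable M" "Y \<in> borel_measurable M"
    and "continuous_on {0..1} \<phi>" "has_associated_copula M X Y (C_theta \<phi> \<theta>)"
    and "symmetric_about M X a"
  defines "u \<equiv> \<lambda>x. cdf (distr M borel X) x" and "v \<equiv> \<lambda>y. cdf (distr M borel Y) y"
  shows "joint_cdf M (\<lambda>w. a - X w) (\<lambda>w. Y w - b) x y
    = u (a + x) * v (b + y) - \<theta> * \<phi> (1 - u (a + x)) * \<phi> (v (b + y))"
  using joint_cdf_reflect_snd[OF assms(1,3,2,4) has_associated_copula_swap[OF assms(5)] assms(6), of b y x]
  unfolding u_def v_def by (simp add: joint_cdf_commute[of M _ "\<lambda>w. a - X w"] mult_ac)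

section \<open>Functional equations for \<phi> on the whole unit interval\<close>

lemma cdf_distr_surj:
  assumes "prob_space M" "X \<in> borel_measurable M"
    and cont: "continuous_on UNIV (cdf (distr M borel X))" and u: "0 < u" "u < 1"
  obtains x where "cdf (distr M borel X) (a + x) = u"
proof -
  interpret real_distribution "distr M borel X"
    using assms(1,2) by (rule prob_space.real_distribution_distr)
  \<comment> \<open>The limits 0 and 1 at the two infinities give a value below \<open>u\<close> and
    one above it, and the intermediate value theorem applies between them. The limits themselves may
    not be attained, hence the restriction to \<open>0 < u < 1\<close>.\<close>
  obtain p where p: "cdf (distr M borel X) p < u"
    using order_tendstoD(2)[OF cdf_lim_at_bot u(1)] by (auto simp: eventually_at_bot_linorder)
  obtain q where q: "u < cdf (distr M borel X) q"
    using order_tendstoD(1)[OF cdf_lim_at_top_prob u(2)] by (auto simp: eventually_at_top_linorder)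
  have "p \<le> q"
    using p q cdf_nondecreasing[of q p] by force
  then obtain z where "cdf (distr M borel X) z = u"
    using IVT'[of "cdf (distr M borel X)" p u q] p q cont continuous_on_subset by force
  then show thesis using that[of "z - a"] by simp
qed

text \<open>Taking \<open>u = v = t\<close> with \<open>\<phi> t \<noteq> 0\<close> fixes a sign in
  \<open>\<phi> (1 - t) = \<plusminus> \<phi> t\<close>; keeping \<open>u = t\<close> and dividing
  by \<open>\<phi> t\<close> spreads this one sign to all \<open>v\<close>. The zero function is
  both even and odd about 1/2.\<close>

lemma even_or_odd_if_product_reflects:
  fixes \<phi> :: "real \<Rightarrow> real"
  assumes eq: "\<And>u v. u \<in> {0..1} \<Longrightarrow> v \<in> {0..1} \<Longrightarrow> \<phi> u * \<phi> v = \<phi> (1 - u) * \<phi> (1 - v)"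
  shows "(\<forall>u\<in>{0..1}. \<phi> u = \<phi> (1 - u)) \<or> (\<forall>u\<in>{0..1}. \<phi> u = - \<phi> (1 - u))"
proof (cases "\<exists>t\<in>{0..1}. \<phi> t \<noteq> 0")
  case True
  then obtain t where t: "t \<in> {0..1}" "\<phi> t \<noteq> 0" by blast
  have "(\<phi> t)\<^sup>2 = (\<phi> (1 - t))\<^sup>2"
    using eq[OF t(1) t(1)] by (simp add: power2_eq_square)
  then consider "\<phi> (1 - t) = \<phi> t" | "\<phi> (1 - t) = - \<phi> t"
    by (metis power2_eq_iff minus_minus)
  then show ?thesis
  proof cases
    case 1
    then have "\<phi> v = \<phi> (1 - v)" if "v \<in> {0..1}" for v
      using eq[OF t(1) that] t(2) by simp
    then show ?thesis by blast
  next
    case 2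
    then have "\<phi> v = - \<phi> (1 - v)" if "v \<in> {0..1}" for v
      using eq[OF t(1) that] t(2) by (metis minus_mult_commute mult_left_cancel)
    then show ?thesis by blast
  qed
next
  case False
  then show ?thesis by simp
qed

text \<open>The conditions on \<phi> are sufficient in general, whereas their necessity is claimed
  for \<theta> nonzero and continuous margins. If \<theta> is 0, then \<open>X\<close> and
  \<open>Y\<close> are independent and marginal symmetry yields joint symmetry for every \<phi>. If
  \<open>X\<close> is constant, then \<open>?F\<close> takes only the values 0 and 1, where \<phi>
  vanishes, and again \<phi> is not constrained.\<close>

theorem theorem2:
  fixes \<phi> :: "real \<Rightarrow> real" and \<theta> :: real
    and M :: "'w measure" and X Y :: "'w \<Rightarrow> real"
  assumes "\<phi> 0 = 0" and "\<phi> 1 = 0"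
    and "\<forall>x\<in>{0..1}. \<forall>y\<in>{0..1}. \<bar>\<phi> x - \<phi> y\<bar> \<le> \<bar>x - y\<bar>"
    and "\<theta> \<in> {-1..1}"
    and "prob_space M"
    and "X \<in> borel_measurable M" and "Y \<in> borel_measurable M"
    and "has_associated_copula M X Y (C_theta \<phi> \<theta>)"
  shows "(identically_distributed M X Y \<longrightarrow> exchangeable M X Y) \<and>
    (\<forall>a b. marginally_symmetric M X Y a b \<longrightarrow>
      ((\<forall>u\<in>{0..1}. \<phi> u = \<phi> (1 - u)) \<or> (\<forall>u\<in>{0..1}. \<phi> u = - \<phi> (1 - u))
         \<longrightarrow> radially_symmetric M X Y a b) \<and>
      ((\<forall>u\<in>{0..1}. \<phi> u = - \<phi> (1 - u)) \<longrightarrow> jointly_symmetric M X Y a b) \<and>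
      (\<theta> \<noteq> 0 \<and> continuous_on UNIV (cdf (distr M borel X)) \<and>
         continuous_on UNIV (cdf (distr M borel Y)) \<longrightarrow>
        (radially_symmetric M X Y a b \<longleftrightarrow>
           (\<forall>u\<in>{0..1}. \<phi> u = \<phi> (1 - u)) \<or> (\<forall>u\<in>{0..1}. \<phi> u = - \<phi> (1 - u))) \<and>
        (jointly_symmetric M X Y a b \<longleftrightarrow> (\<forall>u\<in>{0..1}. \<phi> u = - \<phi> (1 - u)))))"
proof -
  have cont: "continuous_on {0..1} \<phi>"
    by (rule lipschitz_on_continuous_on[of 1])
      (use assms(3) in \<open>auto intro!: lipschitz_onI simp: dist_real_def\<close>)
  let ?F = "cdf (distr M borel X)" and ?G = "cdf (distr M borel Y)"
  let ?even = "\<forall>u\<in>{0..1}. \<phi> u = \<phi> (1 - u)" and ?odd = "\<forall>u\<in>{0..1}. \<phi> u = - \<phi> (1 - u)"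
  note copula = assms(5-7) cont assms(8)
  have F: "?F x \<in> {0..1}" and G: "?G x \<in> {0..1}" for x
    using assms cdf_distr_in_unit by blast+
  have exch: "exchangeable M X Y" if "identically_distributed M X Y"
  proof -
    have "joint_cdf M X Y x y = joint_cdf M Y X x y" for x y
      using assms(8) has_associated_copula_swap[OF assms(8)] that
      by (simp add: has_associated_copula_def identically_distributed_def)
    then show ?thesis
      unfolding exchangeable_def by (intro distr_pair_eqI assms) blast
  qed
  have symmetries: "(?even \<or> ?odd \<longrightarrow> radially_symmetric M X Y a b) \<and>
      (?odd \<longrightarrow> jointly_symmetric M X Y a b) \<and>
      (\<theta> \<noteq> 0 \<and> continuous_on UNIV ?F \<and> continuous_on UNIV ?G \<longrightarrow>
        (radially_symmetric M X Y a b \<longleftrightarrow> ?even \<or> ?odd) \<and> (jointly_symmetric M X Y a b \<longleftrightarrow> ?odd))"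
    if "marginally_symmetric M X Y a b" for a b
  proof -
    have X: "symmetric_about M X a" and Y: "symmetric_about M Y b"
      using that by (auto simp: marginally_symmetric_def)
    note cdfs = joint_cdf_shift[OF copula] joint_cdf_reflect_both[OF copula X Y]
      joint_cdf_reflect_snd[OF copula Y] joint_cdf_reflect_fst[OF copula X] C_theta_def
    have radial_iff: "radially_symmetric M X Y a b \<longleftrightarrow>
        (\<forall>x y. \<theta> * \<phi> (?F (a + x)) * \<phi> (?G (b + y))
          = \<theta> * \<phi> (1 - ?F (a + x)) * \<phi> (1 - ?G (b + y)))"
      by (simp add: radially_symmetric_def fun_eq_iff cdfs)
    have joint_iff: "jointly_symmetric M X Y a b \<longleftrightarrow> radially_symmetric M X Y a b \<and>
        (\<forall>x y. \<theta> * \<phi> (?F (a + x)) * \<phi> (?G (b + y))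
          = - (\<theta> * \<phi> (?F (a + x)) * \<phi> (1 - ?G (b + y)))) \<and>
        (\<forall>x y. \<theta> * \<phi> (?F (a + x)) * \<phi> (?G (b + y))
          = - (\<theta> * \<phi> (1 - ?F (a + x)) * \<phi> (?G (b + y))))"
    proof -
      \<comment> \<open>Here \<open>p\<close> is the product of the two marginal values, which is
        common to all four joint distribution functions and cancels.\<close>
      have "p + s = p - t \<longleftrightarrow> s = - t" for p s t :: real
        by linarith
      then show ?thesis
        unfolding jointly_symmetric_def radially_symmetric_def fun_eq_iff cdfs by (simp only:)
    qed
    have radial: "radially_symmetric M X Y a b" if "?even \<or> ?odd"
      using that
    proof
      assume ?even
      have "\<phi> (1 - ?F x) = \<phi> (?F x)" "\<phi> (1 - ?G x) = \<phi> (?G x)" for x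
        using \<open>?even\<close>[rule_format, OF F, of x] \<open>?even\<close>[rule_format, OF G, of x] by linarith+
      then show ?thesis unfolding radial_iff by simp
    next
      assume ?odd
      have "\<phi> (1 - ?F x) = - \<phi> (?F x)" "\<phi> (1 - ?G x) = - \<phi> (?G x)" for x
        using \<open>?odd\<close>[rule_format, OF F, of x] \<open>?odd\<close>[rule_format, OF G, of x] by linarith+
      then show ?thesis unfolding radial_iff by simp
    qed
    have joint: "jointly_symmetric M X Y a b" if ?odd
    proof -
      have "\<phi> (1 - ?F x) = - \<phi> (?F x)" "\<phi> (1 - ?G x) = - \<phi> (?G x)" for x
        using that[rule_format, OF F, of x] that[rule_format, OF G, of x] by linarith+
      then show ?thesis unfolding joint_iff using radial[OF disjI2[OF that]] by (simp only:) simp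
    qed
    have "(radially_symmetric M X Y a b \<longrightarrow> ?even \<or> ?odd) \<and> (jointly_symmetric M X Y a b \<longrightarrow> ?odd)"
      if \<theta>: "\<theta> \<noteq> 0" and cF: "continuous_on UNIV ?F" and cG: "continuous_on UNIV ?G"
    proof (intro conjI impI)
      have range: "\<exists>x. ?F (a + x) = u" "\<exists>y. ?G (b + y) = u" if "0 < u" "u < 1" for u
        using cdf_distr_surj[OF assms(5,6) cF that] cdf_distr_surj[OF assms(5,7) cG that] by metis+
      show "?even \<or> ?odd" if "radially_symmetric M X Y a b"
      proof (rule even_or_odd_if_product_reflects)
        fix u v :: real assume uv: "u \<in> {0..1}" "v \<in> {0..1}"
        show "\<phi> u * \<phi> v = \<phi> (1 - u) * \<phi> (1 - v)"
        \<comment> \<open>If \<open>u\<close> or \<open>v\<close> is an endpoint, so is its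
          reflection, and both products vanish. Otherwise both are attained by the margins, and
          \<theta> cancels.\<close>
        proof (cases "u \<in> {0, 1} \<or> v \<in> {0, 1}")
          case False
          then obtain x y where "?F (a + x) = u" "?G (b + y) = v"
            using range[of u] range[of v] uv by force
          then show ?thesis using that \<theta> unfolding radial_iff by force
        qed (use assms(1,2) in auto)
      qed
      show ?odd if J: "jointly_symmetric M X Y a b"
      \<comment> \<open>Comparing the original pair with the one reflected only in \<open>Y\<close>
        gives \<open>\<phi> t * \<phi> v = - \<phi> t * \<phi> (1 - v)\<close>, so a single
        \<open>t\<close> with \<open>\<phi> t \<noteq> 0\<close> makes \<phi> odd. Such a
        \<open>t\<close> is interior, hence a value of
        \<open>x \<mapsto> ?F (a + x)\<close>.\<close>
      proof (cases "\<exists>t\<in>{0..1}. \<phi> t \<noteq> 0")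
        case True
        then obtain t where t: "0 < t" "t < 1" "\<phi> t \<noteq> 0"
          using assms(1,2) by (metis atLeastAtMost_iff order_le_less)
        show ?thesis
        proof
          fix v :: real assume v: "v \<in> {0..1}"
          show "\<phi> v = - \<phi> (1 - v)"
          proof (cases "v \<in> {0, 1}")
            case False
            then obtain x y where "?F (a + x) = t" "?G (b + y) = v"
              using range(1)[of t] range(2)[of v] v t by force
            then have "\<theta> * \<phi> t * \<phi> v = \<theta> * \<phi> t * - \<phi> (1 - v)"
              using J unfolding joint_iff by force
            then show ?thesis using \<theta> t(3) by (simp only: mult_cancel_left) simp
          qed (use assms(1,2) in auto)
        qed
      next
        case False
        then show ?thesis by simp
      qed
    qed
    then show ?thesis using radial joint by blast
  qed
  show ?thesis using exch symmetries by blast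
qed

end
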